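(* For any path-connected ANR space $X$, $\mathsf{icat}(X)\le\mathsf{iTC}(X)$.
   Context: $I=[0,1]$. For a metric space $Z$ and $n\ge 1$, $\mathcal B_n(Z)$ is the space of probability measures on $Z$ whose support has at most $n$ points, written as finite formal convex combinations $\sum\lambda_z z$ with $\lambda_z>0$, $\sum\lambda_z=1$, equipped with the Lévy–Prokhorov metric; $\delta_z$ is the Dirac measure at $z$. $P(Z)$ is the space of continuous paths $I\to Z$ with the compact-open topology. Define $\Phi_n:\mathcal B_n(P(X))\to P(\mathcal B_n(X))$ by $\Phi_n(\sum\lambda_\alpha\alpha)(t)=\sum\lambda_\alpha\alpha(t)$. A path $f\in P(\mathcal B_n(X))$ is resolvable if $f=\Phi_n(\mu)$ for some $\mu\in\mathcal B_n(P(X))$; $RP(\mathcal B_n(X))\subset P(\mathcal B_n(X))$ is the subspace of resolvable paths. Given a basepoint $x_0\in X$, $RP_0(\mathcal B_k(X))=\{f\in RP(\mathcal B_k(X)) : f(1)=\delta_{x_0}\}$. $\mathsf{iTC}(X)$ is the minimal integer $n\ge 0$ such that there is a continuous map $s:X\times X\to RP(\mathcal B_{n+1}(X))$ with $s(x,y)(0)=\delta_x$ and $s(x,y)(1)=\delta_y$ for all $(x,y)\in X\times X$. $\mathsf{icat}(X)$ is the minimal integer $n\ge 0$ such that there is a continuous $H:X\to RP_0(\mathcal B_{n+1}(X))$ with $H(x)(0)=\delta_x$ for all $x\in X$. (Both are infinite if no such $n$ exists.) *)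

theory Defs
  imports "HOL-Probability.Probability"
begin

section \<open>Absolute neighbourhood retracts for metrizable spaces\<close>

text \<open>
  The library predicate \<open>ANR\<close> only tests closed copies of its argument inside \<open>'a \<times> real\<close>, which is
  meant for subsets of Euclidean spaces. Here all metrizable spaces \<open>Y\<close> containing a closed copy
  of \<open>X\<close> are tested. Quantification over types being unavailable, \<open>Y\<close> is carried by a subset of
  \<open>'a \<Rightarrow> real\<close>. This loses nothing: by Kuratowski and Wojdyslawski, \<open>X\<close> is closed in the convex hull of
  its image in the space of bounded functions \<open>X \<rightarrow> real\<close>, and by Dugundji's extension theorem
  a neighbourhood retraction there yields one for every closed embedding of \<open>X\<close> in a metrizable space.
\<close>

definition ANR_space :: "'a topology \<Rightarrow> bool" where
  "ANR_space X \<longleftrightarrow> metrizable_space X \<and>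
     (\<forall>(Y :: ('a \<Rightarrow> real) topology) S.
        metrizable_space Y \<and> closedin Y S \<and> X homeomorphic_space subtopology Y S \<longrightarrow>
        (\<exists>U. openin Y U \<and> S \<subseteq> U \<and> S retract_of_space subtopology Y U))"


section \<open>Finitely supported probability measures with the Levy--Prokhorov metric\<close>

definition neighbourhood_of :: "'a metric \<Rightarrow> 'a set \<Rightarrow> real \<Rightarrow> 'a set" where
  "neighbourhood_of Z A \<epsilon> = {z \<in> mspace Z. \<exists>a\<in>A. mdist Z a z < \<epsilon>}"

definition borel_sets_of :: "'a metric \<Rightarrow> 'a set set" where
  "borel_sets_of Z = sigma_sets (mspace Z) {U. openin (mtopology_of Z) U}"

definition levy_prokhorov :: "'a metric \<Rightarrow> 'a pmf \<Rightarrow> 'a pmf \<Rightarrow> real" where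
  "levy_prokhorov Z p q = Inf {\<epsilon>. \<epsilon> > 0 \<and>
     (\<forall>A \<in> borel_sets_of Z.
        measure_pmf.prob p A \<le> measure_pmf.prob q (neighbourhood_of Z A \<epsilon>) + \<epsilon> \<and>
        measure_pmf.prob q A \<le> measure_pmf.prob p (neighbourhood_of Z A \<epsilon>) + \<epsilon>)}"

definition finite_measures :: "nat \<Rightarrow> 'a set \<Rightarrow> 'a pmf set" where
  "finite_measures n S = {p. set_pmf p \<subseteq> S \<and> finite (set_pmf p) \<and> card (set_pmf p) \<le> n}"

definition \<B> :: "nat \<Rightarrow> 'a metric \<Rightarrow> 'a pmf metric" where
  "\<B> n Z = metric (finite_measures n (mspace Z), levy_prokhorov Z)"

context
  fixes Z :: "'a metric"
begin

private definition LPset :: "'a pmf \<Rightarrow> 'a pmf \<Rightarrow> real set" where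
  "LPset p q = {\<epsilon>. \<epsilon> > 0 \<and>
     (\<forall>A \<in> borel_sets_of Z.
        measure_pmf.prob p A \<le> measure_pmf.prob q (neighbourhood_of Z A \<epsilon>) + \<epsilon> \<and>
        measure_pmf.prob q A \<le> measure_pmf.prob p (neighbourhood_of Z A \<epsilon>) + \<epsilon>)}"

private lemma LP_eq: "levy_prokhorov Z p q = Inf (LPset p q)"
  by (simp add: levy_prokhorov_def LPset_def)

private lemma one_in: "1 \<in> LPset p q"
proof -
  have "measure_pmf.prob p A \<le> measure_pmf.prob q B + 1" for p q :: "'a pmf" and A B :: "'a set"
    using measure_pmf.prob_le_1[of p A] measure_nonneg[of q B] by linarith
  then show ?thesis by (simp add: LPset_def)
qed

private lemma bdd: "bdd_below (LPset p q)"
  by (rule bdd_belowI[of _ 0]) (simp add: LPset_def)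

private lemma LP_nonneg: "levy_prokhorov Z p q \<ge> 0"
  unfolding LP_eq
proof (rule cInf_greatest)
  show "LPset p q \<noteq> {}" using one_in by blast
qed (simp add: LPset_def)

private lemma LP_commute: "levy_prokhorov Z p q = levy_prokhorov Z q p"
  unfolding levy_prokhorov_def by (subst conj_commute) (rule refl)

private lemma borel_subset: "A \<in> borel_sets_of Z \<Longrightarrow> A \<subseteq> mspace Z"
  unfolding borel_sets_of_def
  by (erule sigma_sets_into_sp[rotated]) (use openin_subset[of "mtopology_of Z"] in auto)

private lemma neighbourhood_borel:
  assumes "A \<subseteq> mspace Z"
  shows "neighbourhood_of Z A \<epsilon> \<in> borel_sets_of Z"
proof -
  interpret Metric_space "mspace Z" "mdist Z" by simp
  have "neighbourhood_of Z A \<epsilon> = (\<Union>a \<in> A. mball a \<epsilon>)"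
    using assms unfolding neighbourhood_of_def by (auto simp: subset_iff)
  moreover have "openin mtopology (\<Union>a \<in> A. mball a \<epsilon>)"
    by (intro openin_Union) auto
  ultimately have "openin (mtopology_of Z) (neighbourhood_of Z A \<epsilon>)"
    by (simp add: mtopology_of_def)
  then show ?thesis
    unfolding borel_sets_of_def by (intro sigma_sets.Basic CollectI)
qed

private lemma neighbourhood_neighbourhood:
  assumes "A \<subseteq> mspace Z"
  shows "neighbourhood_of Z (neighbourhood_of Z A \<epsilon>) \<delta> \<subseteq> neighbourhood_of Z A (\<epsilon> + \<delta>)"
proof
  interpret Metric_space "mspace Z" "mdist Z" by simp
  fix z assume "z \<in> neighbourhood_of Z (neighbourhood_of Z A \<epsilon>) \<delta>"
  then obtain y a where *: "z \<in> mspace Z" "y \<in> mspace Z" "a \<in> A" "mdist Z a y < \<epsilon>" "mdist Z y z < \<delta>"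
    by (auto simp: neighbourhood_of_def)
  then have "mdist Z a z < \<epsilon> + \<delta>"
    using triangle[of a y z] assms by (simp add: subset_iff)
  with * show "z \<in> neighbourhood_of Z A (\<epsilon> + \<delta>)"
    by (auto simp: neighbourhood_of_def)
qed

private lemma LPset_add:
  assumes "\<epsilon> \<in> LPset p q" "\<delta> \<in> LPset q r"
  shows "\<epsilon> + \<delta> \<in> LPset p r"
proof -
  have "measure_pmf.prob p A \<le> measure_pmf.prob r (neighbourhood_of Z A (\<epsilon> + \<delta>)) + (\<epsilon> + \<delta>)"
    if A: "A \<in> borel_sets_of Z" and "\<epsilon> \<in> LPset p q" "\<delta> \<in> LPset q r" for A \<epsilon> \<delta> p q r
  proof -
    have "measure_pmf.prob p A \<le> measure_pmf.prob q (neighbourhood_of Z A \<epsilon>) + \<epsilon>"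
      using that by (auto simp: LPset_def)
    moreover have "measure_pmf.prob q (neighbourhood_of Z A \<epsilon>)
        \<le> measure_pmf.prob r (neighbourhood_of Z (neighbourhood_of Z A \<epsilon>) \<delta>) + \<delta>"
      using that neighbourhood_borel[OF borel_subset[OF A]] by (auto simp: LPset_def)
    moreover have "measure_pmf.prob r (neighbourhood_of Z (neighbourhood_of Z A \<epsilon>) \<delta>)
        \<le> measure_pmf.prob r (neighbourhood_of Z A (\<epsilon> + \<delta>))"
      using neighbourhood_neighbourhood[OF borel_subset[OF A]]
      by (intro measure_pmf.finite_measure_mono) auto
    ultimately show ?thesis by linarith
  qed
  note * = this
  have sym: "\<epsilon> \<in> LPset p q \<Longrightarrow> \<epsilon> \<in> LPset q p" for \<epsilon> p q
    by (auto simp: LPset_def)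
  show ?thesis
    using *[OF _ assms] *[OF _ sym[OF assms(2)] sym[OF assms(1)]] assms
    by (auto simp: LPset_def add.commute)
qed

private lemma LP_triangle: "levy_prokhorov Z p r \<le> levy_prokhorov Z p q + levy_prokhorov Z q r"
proof -
  have "levy_prokhorov Z p r - \<delta> \<le> levy_prokhorov Z p q" if "\<delta> \<in> LPset q r" for \<delta>
    unfolding LP_eq[of p q]
  proof (rule cInf_greatest)
    show "LPset p q \<noteq> {}" using one_in by blast
    fix \<epsilon> assume "\<epsilon> \<in> LPset p q"
    then show "levy_prokhorov Z p r - \<delta> \<le> \<epsilon>"
      using cInf_lower[OF LPset_add[OF _ that] bdd] by (fastforce simp: LP_eq)
  qed
  then have "levy_prokhorov Z p r - levy_prokhorov Z p q \<le> levy_prokhorov Z q r"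
    unfolding LP_eq[of q r] using one_in[of q r]
    by (intro cInf_greatest) (force simp: algebra_simps)+
  then show ?thesis by simp
qed

private lemma LP_self: "levy_prokhorov Z p p = 0"
proof -
  interpret Metric_space "mspace Z" "mdist Z" by simp
  have "\<epsilon> \<in> LPset p p" if "\<epsilon> > 0" for \<epsilon>
  proof -
    have "measure_pmf.prob p A \<le> measure_pmf.prob p (neighbourhood_of Z A \<epsilon>) + \<epsilon>"
      if A: "A \<in> borel_sets_of Z" for A
    proof -
      have "A \<subseteq> neighbourhood_of Z A \<epsilon>"
        using borel_subset[OF A] \<open>\<epsilon> > 0\<close> by (force simp: neighbourhood_of_def)
      then have "measure_pmf.prob p A \<le> measure_pmf.prob p (neighbourhood_of Z A \<epsilon>)"
        by (intro measure_pmf.finite_measure_mono) auto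
      with \<open>\<epsilon> > 0\<close> show ?thesis by linarith
    qed
    with that show ?thesis by (auto simp: LPset_def)
  qed
  then have "levy_prokhorov Z p p \<le> \<epsilon>" if "\<epsilon> > 0" for \<epsilon>
    unfolding LP_eq using that by (intro cInf_lower bdd)
  then have "levy_prokhorov Z p p \<le> 0"
    by (rule dense_ge)
  then show ?thesis
    using LP_nonneg[of p p] by linarith
qed

private lemma LP_zero_le:
  assumes q: "finite (set_pmf q)" "set_pmf q \<subseteq> mspace Z" and x: "x \<in> mspace Z"
    and LP0: "levy_prokhorov Z p q = 0"
  shows "pmf p x \<le> pmf q x"
proof (rule field_le_epsilon)
  interpret Metric_space "mspace Z" "mdist Z" by simp
  fix e :: real assume "e > 0"
  define D where "D = insert e (mdist Z x ` (set_pmf q - {x}))"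
  have fin: "finite D" "D \<noteq> {}" using q by (auto simp: D_def)
  have "Min D > 0"
    using fin q x \<open>e > 0\<close> by (auto simp: D_def Min_gr_iff)
  then obtain \<epsilon> where \<epsilon>: "\<epsilon> \<in> LPset p q" "\<epsilon> < Min D"
    using LP0 cInf_lessD[of "LPset p q" "Min D"] one_in[of p q] unfolding LP_eq by force
  have "closedin mtopology {x}"
    using x by (simp add: Hausdorff_space_mtopology closedin_Hausdorff_sing_eq)
  then have "mspace Z - {x} \<in> borel_sets_of Z"
    by (auto simp: borel_sets_of_def mtopology_of_def closedin_def intro: sigma_sets.Basic)
  then have "mspace Z - (mspace Z - {x}) \<in> borel_sets_of Z"
    unfolding borel_sets_of_def by (rule sigma_sets.Compl)
  then have "{x} \<in> borel_sets_of Z"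
    using x by (simp add: double_diff)
  then have "measure_pmf.prob p {x} \<le> measure_pmf.prob q (neighbourhood_of Z {x} \<epsilon>) + \<epsilon>"
    using \<epsilon> by (auto simp: LPset_def)
  also have "measure_pmf.prob q (neighbourhood_of Z {x} \<epsilon>)
      = measure_pmf.prob q (neighbourhood_of Z {x} \<epsilon> \<inter> set_pmf q)"
    by (simp add: measure_Int_set_pmf)
  also have "\<dots> \<le> measure_pmf.prob q {x}"
  proof (rule measure_pmf.finite_measure_mono)
    show "neighbourhood_of Z {x} \<epsilon> \<inter> set_pmf q \<subseteq> {x}"
    proof
      fix y assume y: "y \<in> neighbourhood_of Z {x} \<epsilon> \<inter> set_pmf q"
      then have "mdist Z x y < Min D" using \<epsilon> by (auto simp: neighbourhood_of_def)
      moreover have "Min D \<le> mdist Z x y" if "y \<noteq> x"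
        using y that fin by (intro Min_le) (auto simp: D_def)
      ultimately show "y \<in> {x}" by force
    qed
  qed auto
  also have "\<epsilon> \<le> e"
    using \<epsilon> fin by (auto simp: D_def)
  finally show "pmf p x \<le> pmf q x + e"
    by (simp add: measure_pmf_single)
qed

lemma Metric_space_levy_prokhorov:
  "Metric_space (finite_measures n (mspace Z)) (levy_prokhorov Z)"
proof
  fix p q assume pq: "p \<in> finite_measures n (mspace Z)" "q \<in> finite_measures n (mspace Z)"
  show "levy_prokhorov Z p q = 0 \<longleftrightarrow> p = q"
  proof
    assume zero: "levy_prokhorov Z p q = 0"
    show "p = q"
    proof (rule pmf_eqI)
      fix x
      show "pmf p x = pmf q x"
      proof (cases "x \<in> mspace Z")
        case True
        then show ?thesis
          using LP_zero_le[of q x p] LP_zero_le[of p x q] pq zero LP_commute[of p q]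
          by (auto simp: finite_measures_def intro: antisym)
      next
        case False
        then have "x \<notin> set_pmf p" "x \<notin> set_pmf q"
          using pq by (auto simp: finite_measures_def)
        then show ?thesis by (simp add: set_pmf_iff)
      qed
    qed
  qed (simp add: LP_self)
qed (rule LP_nonneg, rule LP_commute, rule LP_triangle)

end

lemma mspace_\<B> [simp]: "mspace (\<B> n Z) = finite_measures n (mspace Z)"
  by (simp add: \<B>_def Metric_space.mspace_metric[OF Metric_space_levy_prokhorov])

lemma mdist_\<B> [simp]: "mdist (\<B> n Z) = levy_prokhorov Z"
  by (simp add: \<B>_def Metric_space.mdist_metric[OF Metric_space_levy_prokhorov])


section \<open>Path spaces and resolvable paths\<close>

text \<open>Maps are made extensional so that their values off \<open>topspace X\<close> carry no information.\<close>

definition compact_open_topology :: "'a topology \<Rightarrow> 'b topology \<Rightarrow> ('a \<Rightarrow> 'b) topology" where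
  "compact_open_topology X Y = topology_generated_by
     {{f \<in> extensional (topspace X). continuous_map X Y f \<and> f ` K \<subseteq> U} | K U.
        compactin X K \<and> openin Y U}"

lemma topspace_compact_open_topology [simp]:
  "topspace (compact_open_topology X Y) = {f \<in> extensional (topspace X). continuous_map X Y f}"
    (is "_ = ?C")
proof -
  let ?S = "\<lambda>K U. {f \<in> extensional (topspace X). continuous_map X Y f \<and> f ` K \<subseteq> U}"
  let ?B = "{?S K U | K U. compactin X K \<and> openin Y U}"
  have "?C = ?S {} {}" "compactin X {}" "openin Y {}" by simp_all
  then have "?C \<in> ?B"
    by (intro CollectI exI conjI)
  then have "?C \<subseteq> \<Union>?B"
    by (rule Union_upper)
  moreover have "\<Union>?B \<subseteq> ?C"
    by (rule Union_least) auto
  ultimately show ?thesis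
    unfolding compact_open_topology_def topology_generated_by_topspace by (rule equalityI[rotated])
qed

definition path_space :: "'a topology \<Rightarrow> (real \<Rightarrow> 'a) topology" where
  "path_space Z = compact_open_topology (top_of_set {0..1}) Z"

definition \<Phi> :: "(real \<Rightarrow> 'a) pmf \<Rightarrow> real \<Rightarrow> 'a pmf" where
  "\<Phi> \<mu> = (\<lambda>t\<in>{0..1}. map_pmf (\<lambda>\<alpha>. \<alpha> t) \<mu>)"

definition resolvable :: "nat \<Rightarrow> 'a metric \<Rightarrow> (real \<Rightarrow> 'a pmf) \<Rightarrow> bool" where
  "resolvable n X f \<longleftrightarrow>
     (\<exists>\<mu> \<in> finite_measures n (topspace (path_space (mtopology_of X))). f = \<Phi> \<mu>)"

definition RP :: "nat \<Rightarrow> 'a metric \<Rightarrow> (real \<Rightarrow> 'a pmf) topology" where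
  "RP n X = subtopology (path_space (mtopology_of (\<B> n X))) {f. resolvable n X f}"

definition RP\<^sub>0 :: "nat \<Rightarrow> 'a metric \<Rightarrow> 'a \<Rightarrow> (real \<Rightarrow> 'a pmf) topology" where
  "RP\<^sub>0 n X x\<^sub>0 = subtopology (RP n X) {f. f 1 = return_pmf x\<^sub>0}"


section \<open>The invariants\<close>

text \<open>The infimum of the empty set in \<^typ>\<open>enat\<close> is \<open>\<infinity>\<close>.\<close>

definition iTC :: "'a metric \<Rightarrow> enat" where
  "iTC X = Inf {enat n | n.
     \<exists>s. continuous_map (prod_topology (mtopology_of X) (mtopology_of X)) (RP (n + 1) X) s \<and>
         (\<forall>x \<in> mspace X. \<forall>y \<in> mspace X.
            s (x, y) 0 = return_pmf x \<and> s (x, y) 1 = return_pmf y)}"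

definition icat :: "'a metric \<Rightarrow> 'a \<Rightarrow> enat" where
  "icat X x\<^sub>0 = Inf {enat n | n.
     \<exists>H. continuous_map (mtopology_of X) (RP\<^sub>0 (n + 1) X x\<^sub>0) H \<and>
         (\<forall>x \<in> mspace X. H x 0 = return_pmf x)}"

end

theory Submission
  imports Defs
begin

text \<open>
  Fixing the second endpoint of a motion planner \<open>s\<close> at the basepoint gives a map
  \<open>x \<mapsto> s (x, x\<^sub>0)\<close> that deforms each \<open>x\<close>, along a resolvable path with the same bound on the
  supports, to \<open>x\<^sub>0\<close>. Hence every \<open>n\<close> that is admissible for \<open>iTC\<close> is admissible for
  \<open>icat\<close>, and the two invariants are infima of nested sets.
\<close>

theorem proposition4p16:
  fixes X :: "'a metric" and x\<^sub>0 :: 'a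
  assumes "ANR_space (mtopology_of X)"
    and "path_connected_space (mtopology_of X)"
    and "x\<^sub>0 \<in> mspace X"
  shows "icat X x\<^sub>0 \<le> iTC X"
  unfolding icat_def iTC_def
proof (rule Inf_superset_mono, clarify)
  fix n s
  assume s: "continuous_map (prod_topology (mtopology_of X) (mtopology_of X)) (RP (n + 1) X) s"
    and ends: "\<forall>x\<in>mspace X. \<forall>y\<in>mspace X. s (x, y) 0 = return_pmf x \<and> s (x, y) 1 = return_pmf y"
  define H where "H x = s (x, x\<^sub>0)" for x
  have "continuous_map (mtopology_of X) (prod_topology (mtopology_of X) (mtopology_of X))
          (\<lambda>x. (x, x\<^sub>0))"
    using assms(3) by (intro continuous_map_pairedI) auto
  then have "continuous_map (mtopology_of X) (RP (n + 1) X) H"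
    using continuous_map_compose[OF _ s] by (simp add: H_def [abs_def] o_def)
  then have "continuous_map (mtopology_of X) (RP\<^sub>0 (n + 1) X x\<^sub>0) H"
    using ends assms(3) by (auto simp: RP\<^sub>0_def continuous_map_in_subtopology H_def)
  moreover have "\<forall>x\<in>mspace X. H x 0 = return_pmf x"
    using ends assms(3) by (simp add: H_def)
  ultimately show "\<exists>m. enat n = enat m \<and>
      (\<exists>H. continuous_map (mtopology_of X) (RP\<^sub>0 (m + 1) X x\<^sub>0) H \<and>
           (\<forall>x\<in>mspace X. H x 0 = return_pmf x))"
    by blast
qed

end
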